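(* Let $\mathcal{X}\in\mathbb{R}^{I_1\times\cdots\times I_N}$ be a real $N$th-order tensor, let $n\in\{1,\ldots,N\}$, let $\mathfrak{U}_n\subset\mathbb{R}^{I_n}$ be a linear subspace, and let $\mathbf{P}_n\in\mathbb{R}^{I_n\times I_n}$ be the orthogonal projection matrix onto $\mathfrak{U}_n$. Put $\mathcal{X}_+:=\mathcal{X}\times_n\mathbf{P}_n$, $\mathcal{X}_-:=\mathcal{X}\times_n(\mathbf{I}-\mathbf{P}_n)$, and $\mathbf{R}_n:=2\mathbf{P}_n-\mathbf{I}$. Then $$\mathcal{X}_+\times_n\mathbf{R}_n=\mathcal{X}_+,\qquad \mathcal{X}_-\times_n\mathbf{R}_n=-\mathcal{X}_-.$$
   Context: For a tensor $\mathcal{X}\in\mathbb{R}^{I_1\times\cdots\times I_N}$, a mode-$n$ fiber is the vector $\mathcal{X}(i_1,\ldots,i_{n-1},:,i_{n+1},\ldots,i_N)\in\mathbb{R}^{I_n}$ obtained by fixing all indices except the $n$th. For a matrix $\mathbf{A}\in\mathbb{R}^{J\times I_n}$, the mode-$n$ product $\mathcal{Y}=\mathcal{X}\times_n\mathbf{A}$ is the tensor obtained by left-multiplying each mode-$n$ fiber by $\mathbf{A}$: $\mathcal{Y}(i_1,\ldots,i_{n-1},:,i_{n+1},\ldots,i_N)=\mathbf{A}\,\mathcal{X}(i_1,\ldots,i_{n-1},:,i_{n+1},\ldots,i_N)$. If $\mathfrak{U}_n$ has dimension $r$ and $\mathbf{U}\in\mathbb{R}^{I_n\times r}$ has columns forming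 an orthonormal basis of $\mathfrak{U}_n$, the orthogonal projection matrix onto $\mathfrak{U}_n$ is $\mathbf{P}_n=\mathbf{U}\mathbf{U}^\top$. $\mathbf{I}$ is the $I_n\times I_n$ identity matrix. The pair $(\mathcal{X}_+,\mathcal{X}_-)$ is called the Tensor Orthogonal Subspace Split (TOSS) of $\mathcal{X}$ along mode $n$ with respect to $\mathfrak{U}_n$. *)

theory Defs
  imports "Jordan_Normal_Form.VS_Connect" "HOL-Library.FuncSet"
begin

text \<open>
  Modes are numbered \<open>1, \<dots>, N\<close>. As in the matrix library, the entries along
  mode \<open>k\<close> are numbered \<open>0, \<dots>, I k - 1\<close>. A tensor is a function on multi-indices
  that is zero outside its shape, so equality of tensors is equality of functions and
  negation is the pointwise one.
\<close>

type_synonym tensor = "(nat \<Rightarrow> nat) \<Rightarrow> real"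

definition multi_indices :: "nat \<Rightarrow> (nat \<Rightarrow> nat) \<Rightarrow> (nat \<Rightarrow> nat) set" where
  "multi_indices N I = (\<Pi>\<^sub>E k\<in>{1..N}. {..<I k})"

definition tensors :: "nat \<Rightarrow> (nat \<Rightarrow> nat) \<Rightarrow> tensor set" where
  "tensors N I = {X. \<forall>i. i \<notin> multi_indices N I \<longrightarrow> X i = 0}"

text \<open>The value \<open>i n\<close> plays no role in the fiber: it is overwritten.\<close>

definition fiber :: "(nat \<Rightarrow> nat) \<Rightarrow> nat \<Rightarrow> tensor \<Rightarrow> (nat \<Rightarrow> nat) \<Rightarrow> real vec" where
  "fiber I n X i = vec (I n) (\<lambda>j. X (i(n := j)))"

text \<open>
  The product of a tensor of shape \<open>I\<close> with a \<open>J \<times> I n\<close> matrix has shape \<open>I(n := J)\<close>.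
\<close>

definition mode_product ::
    "nat \<Rightarrow> (nat \<Rightarrow> nat) \<Rightarrow> tensor \<Rightarrow> nat \<Rightarrow> real mat \<Rightarrow> tensor" where
  "mode_product N I X n A =
     (\<lambda>i. if i \<in> multi_indices N (I(n := dim_row A))
          then (A *\<^sub>v fiber I n X i) $ i n else 0)"

abbreviation real_space :: "nat \<Rightarrow> (real, real vec) module" where
  "real_space m \<equiv> module_vec TYPE(real) m"

text \<open>The columns of \<open>B\<close> are pairwise orthonormal and form a basis of the subspace \<open>S\<close>.\<close>

definition orthonormal_basis_columns :: "nat \<Rightarrow> real vec set \<Rightarrow> nat \<Rightarrow> real mat \<Rightarrow> bool" where
  "orthonormal_basis_columns m S r B \<longleftrightarrow>
     B \<in> carrier_mat m r \<and>
     (\<forall>i<r. \<forall>j<r. col B i \<bullet> col B j = (if i = j then 1 else 0)) \<and>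
     vectorspace.basis class_ring (real_space m\<lparr>carrier := S\<rparr>) (set (cols B))"

definition orthogonal_projection_matrix :: "nat \<Rightarrow> real vec set \<Rightarrow> real mat \<Rightarrow> bool" where
  "orthogonal_projection_matrix m S P \<longleftrightarrow>
     (\<exists>r B. r = vectorspace.dim class_ring (real_space m\<lparr>carrier := S\<rparr>) \<and>
            orthonormal_basis_columns m S r B \<and> P = B * B\<^sup>T)"

end

theory Submission
  imports Defs
begin

text \<open>Successive products along one mode compose like matrices
  (\<open>mode_product_mode_product\<close>), so both claims reduce to the matrix identities
  \<open>R * P = P\<close> and \<open>R * (1 - P) = -(1 - P)\<close>, with 1 the identity matrix.
  These hold for every idempotent \<open>P\<close> (\<open>reflection_mult_idem\<close>), and
  \<open>P = B * B\<^sup>T\<close> is idempotent because the columns of \<open>B\<close> are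
  orthonormal. The sign in the second identity passes from the matrix to the tensor by
  \<open>mode_product_uminus\<close>.\<close>

lemma multi_indices_upd:
  assumes "n \<in> {1..N}" "i \<in> multi_indices N (I(n := K))" "j < J"
  shows "i(n := j) \<in> multi_indices N (I(n := J))"
  using assms unfolding multi_indices_def
  by (auto simp: PiE_iff extensional_def split: if_splits)

lemma multi_indices_less:
  assumes "n \<in> {1..N}" "i \<in> multi_indices N (I(n := K))"
  shows "i n < K"
  using PiE_mem[OF assms(2)[unfolded multi_indices_def] assms(1)] by simp

lemma fiber_carrier [simp]: "fiber I n X i \<in> carrier_vec (I n)"
  by (simp add: fiber_def)

lemma fiber_upd [simp]: "fiber I n X (i(n := j)) = fiber I n X i"
  by (simp add: fiber_def)

text \<open>All entries along the new fiber are computed from one and the same fiber of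
  \<open>X\<close>, since changing \<open>i n\<close> does not change that fiber. The size
  \<open>K\<close> is left free so that \<open>i\<close> may come from the shape of a further
  product.\<close>

lemma fiber_mode_product:
  assumes "n \<in> {1..N}" "A \<in> carrier_mat J (I n)" "i \<in> multi_indices N (I(n := K))"
  shows "fiber (I(n := J)) n (mode_product N I X n A) i = A *\<^sub>v fiber I n X i"
proof (rule eq_vecI)
  show "dim_vec (fiber (I(n := J)) n (mode_product N I X n A) i) = dim_vec (A *\<^sub>v fiber I n X i)"
    using assms(2) by (simp add: fiber_def)
next
  fix j
  assume "j < dim_vec (A *\<^sub>v fiber I n X i)"
  then have "j < J" using assms(2) by simp
  \<comment> \<open>The updated index lies in the shape of the product, so
    \<open>mode_product\<close> does not return its default 0 there.\<close>
  moreover have "i(n := j) \<in> multi_indices N (I(n := dim_row A))"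
    using multi_indices_upd[OF assms(1,3) \<open>j < J\<close>] assms(2) by simp
  ultimately show "fiber (I(n := J)) n (mode_product N I X n A) i $ j = (A *\<^sub>v fiber I n X i) $ j"
    by (simp add: fiber_def[of "I(n := J)"] mode_product_def del: index_mult_mat_vec)
qed

text \<open>On each fiber this is associativity of matrix-vector multiplication. Outside the final
  shape, with \<open>K\<close> entries along mode \<open>n\<close>, both sides are 0.\<close>

lemma mode_product_mode_product:
  assumes "n \<in> {1..N}" "A \<in> carrier_mat J (I n)" "B \<in> carrier_mat K J"
  shows "mode_product N (I(n := J)) (mode_product N I X n A) n B = mode_product N I X n (B * A)"
proof
  fix i
  have "B *\<^sub>v fiber (I(n := J)) n (mode_product N I X n A) i = (B * A) *\<^sub>v fiber I n X i"
    if "i \<in> multi_indices N (I(n := K))"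
    using fiber_mode_product[where I = I and X = X, OF assms(1,2) that]
      assoc_mult_mat_vec[OF assms(3,2) fiber_carrier[of I n X i]] by simp
  then show "mode_product N (I(n := J)) (mode_product N I X n A) n B i = mode_product N I X n (B * A) i"
    using assms(3) by (simp add: mode_product_def del: index_mult_mat_vec)
qed

lemma mode_product_uminus:
  assumes "n \<in> {1..N}" "A \<in> carrier_mat J (I n)"
  shows "mode_product N I X n (- A) = - mode_product N I X n A"
proof
  fix i
  \<comment> \<open>The bound \<open>i n < J\<close> makes the entry a row of \<open>A\<close> times
    the fiber, where the sign can be pulled out.\<close>
  have "((- A) *\<^sub>v fiber I n X i) $ i n = - (A *\<^sub>v fiber I n X i) $ i n"
    if "i \<in> multi_indices N (I(n := J))"
    using multi_indices_less[OF assms(1) that] assms(2) by (simp add: fiber_def)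
  then show "mode_product N I X n (- A) i = (- mode_product N I X n A) i"
    using assms(2) by (simp add: mode_product_def del: index_mult_mat_vec)
qed

text \<open>The entries of the Gram matrix are the inner products of the columns of
  \<open>B\<close>.\<close>

lemma orthonormal_columns_imp_gram:
  assumes "orthonormal_basis_columns m S r B"
  shows "B\<^sup>T * B = 1\<^sub>m r"
  using assms unfolding orthonormal_basis_columns_def by (intro eq_matI) auto

lemma orthogonal_projection_matrix_carrier:
  assumes "orthogonal_projection_matrix m S P"
  shows "P \<in> carrier_mat m m"
  using assms unfolding orthogonal_projection_matrix_def orthonormal_basis_columns_def by auto

lemma orthogonal_projection_matrix_idem:
  assumes "orthogonal_projection_matrix m S P"
  shows "P * P = P"
proof -
  obtain r B where B: "orthonormal_basis_columns m S r B" and P: "P = B * B\<^sup>T"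
    using assms unfolding orthogonal_projection_matrix_def by blast
  from B have c: "B \<in> carrier_mat m r" unfolding orthonormal_basis_columns_def by simp
  then have ct: "B\<^sup>T \<in> carrier_mat r m" by simp
  \<comment> \<open>Regrouping isolates the Gram matrix in the middle, which is the
    identity.\<close>
  have "P * P = B * ((B\<^sup>T * B) * B\<^sup>T)"
    unfolding P using assoc_mult_mat[OF c ct mult_carrier_mat[OF c ct]]
      assoc_mult_mat[OF ct c ct] by simp
  then show ?thesis
    using orthonormal_columns_imp_gram[OF B] ct P by simp
qed

text \<open>Write \<open>R\<close> for \<open>2P - 1\<close>. Then \<open>R * P = 2P - P = P\<close>
  by idempotence, and hence \<open>R * (1 - P) = R - P = P - 1\<close>.\<close>

lemma reflection_mult_idem:
  fixes P :: "'a :: comm_ring_1 mat"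
  assumes P: "P \<in> carrier_mat m m" and idem: "P * P = P"
  shows "(2 \<cdot>\<^sub>m P - 1\<^sub>m m) * P = P"
    and "(2 \<cdot>\<^sub>m P - 1\<^sub>m m) * (1\<^sub>m m - P) = - (1\<^sub>m m - P)"
proof -
  have R: "2 \<cdot>\<^sub>m P - 1\<^sub>m m \<in> carrier_mat m m"
    using P by (intro minus_carrier_mat) auto
  have "(2 \<cdot>\<^sub>m P - 1\<^sub>m m) * P = 2 \<cdot>\<^sub>m P - P"
    using P idem mult_smult_assoc_mat[OF P P, of 2]
    by (subst minus_mult_distrib_mat[of _ m m]) auto
  also have "\<dots> = P"
    using P by (intro eq_matI) auto
  finally show RP: "(2 \<cdot>\<^sub>m P - 1\<^sub>m m) * P = P" .
  have "(2 \<cdot>\<^sub>m P - 1\<^sub>m m) * (1\<^sub>m m - P) = (2 \<cdot>\<^sub>m P - 1\<^sub>m m) - P"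
    using mult_minus_distrib_mat[OF R one_carrier_mat P] R RP by simp
  also have "\<dots> = - (1\<^sub>m m - P)"
    using P by (intro eq_matI) auto
  finally show "(2 \<cdot>\<^sub>m P - 1\<^sub>m m) * (1\<^sub>m m - P) = - (1\<^sub>m m - P)" .
qed

theorem mainTheorem3:
  fixes N n :: nat and I :: "nat \<Rightarrow> nat"
    and X X_plus X_minus :: tensor
    and S :: "real vec set" and P R :: "real mat"
  assumes "X \<in> tensors N I"
    and "n \<in> {1..N}"
    and "VectorSpace.subspace class_ring S (real_space (I n))"
    and "orthogonal_projection_matrix (I n) S P"
    and "X_plus = mode_product N I X n P"
    and "X_minus = mode_product N I X n (1\<^sub>m (I n) - P)"
    and "R = 2 \<cdot>\<^sub>m P - 1\<^sub>m (I n)"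
  shows "mode_product N I X_plus n R = X_plus \<and>
         mode_product N I X_minus n R = - X_minus"
proof -
  note P = orthogonal_projection_matrix_carrier[OF assms(4)]
  note refl = reflection_mult_idem[OF P orthogonal_projection_matrix_idem[OF assms(4)],
      folded assms(7)]
  have Q: "1\<^sub>m (I n) - P \<in> carrier_mat (I n) (I n)"
    using P by (rule minus_carrier_mat)
  have R: "R \<in> carrier_mat (I n) (I n)"
    unfolding assms(7) by (intro minus_carrier_mat) simp
  \<comment> \<open>Multiplying by the square matrix \<open>P\<close> keeps the shape:
    \<open>I(n := I n)\<close> simplifies to \<open>I\<close>, so the composition lemma
    applies.\<close>
  have "mode_product N I X_plus n R = X_plus"
    using mode_product_mode_product[where I = I and X = X, OF assms(2) P R] refl(1) assms(5) by simp
  moreover have "mode_product N I X_minus n R = - X_minus"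
    using mode_product_mode_product[where I = I and X = X, OF assms(2) Q R] refl(2)
      mode_product_uminus[where I = I and X = X, OF assms(2) Q] assms(6) by simp
  ultimately show ?thesis ..
qed

end
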